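(* Let $\tau=\frac{1+\sqrt5}{2}$ and let $C=\begin{pmatrix}0&1\\1&1\end{pmatrix}$ be its companion matrix. Let $q,N\in\mathbb{N}$ with $q>2$ and $N>1$. If $C^N\equiv -I \pmod q$, then $q$ has the Midy property in base $\tau$. Moreover, every $p\in\mathbb{N}$ with $0<p<q$ and $p$ coprime with $q$ testifies to the Midy property of $q$ in base $\tau$.
   Context: For real $\beta>1$, the $\beta$-transformation is $T:[0,1]\to[0,1)$, $T(x)=\beta x-\lfloor \beta x\rfloor$. The $\beta$-expansion of $x\in(0,1)$ is $(x)_\beta=0.x_1x_2x_3\cdots$ with digits $x_i=\lfloor \beta T^{i-1}(x)\rfloor$, so that $x=\sum_{i\ge1}x_i\beta^{-i}$. It is purely periodic if the digit sequence $x_1x_2x_3\cdots$ equals $(c_1\cdots c_m)^\omega$ (infinite repetition of the block $c_1\cdots c_m$) for some $m\ge 1$. Midy property: $q\in\mathbb{N}$ has the Midy property in base $\beta$ if there exists a positive integer $p<q$ coprime with $q$ such that (a) the $\beta$-expansion of $p/q$ is purely periodic, $(p/q)_\beta=0.(c_1c_2\cdots c_{2n})^\omega$, where $2n$ (an even number, $n\ge1$) is the length of the shortest period; and (b) $x+y=\beta^n-1$, where $x=\sum_{i=1}^n c_i\beta^{n-i}$ and $y=\sum_{i=1}^n c_{n+i}\beta^{n-i}$. Any positive integer $p<q$ coprime with $q$ satisfying (a) and (b) is said to testify to the Midy property of $q$ in base $\beta$. Matrix congruences modulo $q$ are entrywise; $I$ is the $2\times2$ identity matrix. *)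

theory Defs
  imports
    Complex_Main
    "HOL-Number_Theory.Cong"
    "Jordan_Normal_Form.Matrix"
begin

definition beta_trans :: "real \<Rightarrow> real \<Rightarrow> real" where
  "beta_trans \<beta> x = \<beta> * x - real_of_int \<lfloor>\<beta> * x\<rfloor>"

text \<open>The digits are numbered from 1; the value at index 0 is irrelevant.\<close>

definition beta_digit :: "real \<Rightarrow> real \<Rightarrow> nat \<Rightarrow> int" where
  "beta_digit \<beta> x i = \<lfloor>\<beta> * (beta_trans \<beta> ^^ (i - 1)) x\<rfloor>"

text \<open>The digit sequence of \<open>x\<close> is \<open>(c\<^sub>1\<dots>c\<^sub>m)\<^sup>\<omega>\<close>, where \<open>cs = [c\<^sub>1, \<dots>, c\<^sub>m]\<close>,
  so that \<open>c\<^sub>i\<close> is \<open>cs ! (i - 1)\<close>.\<close>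

definition purely_periodic_with :: "real \<Rightarrow> real \<Rightarrow> int list \<Rightarrow> bool" where
  "purely_periodic_with \<beta> x cs \<longleftrightarrow>
     cs \<noteq> [] \<and> (\<forall>i\<ge>1. beta_digit \<beta> x i = cs ! ((i - 1) mod length cs))"

definition shortest_period :: "real \<Rightarrow> real \<Rightarrow> int list \<Rightarrow> bool" where
  "shortest_period \<beta> x cs \<longleftrightarrow>
     purely_periodic_with \<beta> x cs \<and>
     (\<forall>ds. purely_periodic_with \<beta> x ds \<longrightarrow> length cs \<le> length ds)"

definition testifies_midy :: "real \<Rightarrow> nat \<Rightarrow> nat \<Rightarrow> bool" where
  "testifies_midy \<beta> q p \<longleftrightarrow>
     0 < p \<and> p < q \<and> coprime p q \<and>
     (\<exists>n cs. n \<ge> 1 \<and> length cs = 2 * n \<and> shortest_period \<beta> (real p / real q) cs \<and>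
        (\<Sum>i = 1..n. real_of_int (cs ! (i - 1)) * \<beta> ^ (n - i)) +
        (\<Sum>i = 1..n. real_of_int (cs ! (n + i - 1)) * \<beta> ^ (n - i)) = \<beta> ^ n - 1)"

definition midy_property :: "real \<Rightarrow> nat \<Rightarrow> bool" where
  "midy_property \<beta> q \<longleftrightarrow> (\<exists>p. testifies_midy \<beta> q p)"

definition tau :: real where
  "tau = (1 + sqrt 5) / 2"

definition tau_companion :: "int mat" where
  "tau_companion = mat_of_rows_list 2 [[0, 1], [1, 1]]"

definition mat_cong :: "int mat \<Rightarrow> int mat \<Rightarrow> int \<Rightarrow> bool" where
  "mat_cong A B m \<longleftrightarrow>
     dim_row A = dim_row B \<and> dim_col A = dim_col B \<and>
     (\<forall>i < dim_row A. \<forall>j < dim_col A. [A $$ (i, j) = B $$ (i, j)] (mod m))"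

end

theory Submission
  imports Defs
begin

text \<open>Lift \<open>T\<close> to pairs \<open>(z, y)\<close>, where \<open>y\<close> is the Galois conjugate of the element \<open>z\<close>
  of \<open>\<rat>(\<tau>)\<close> and evolves by \<open>y \<mapsto> (1 - \<tau>) y - \<lfloor>\<tau> z\<rfloor>\<close>. The region consisting of
  \<open>[0, 1/\<tau>) \<times> (-\<tau>, 1)\<close> and \<open>[1/\<tau>, 1) \<times> (-1/\<tau>, 1)\<close> is invariant (it is the natural
  extension of \<open>T\<close>) and contains \<open>(x, x)\<close> for rational \<open>x = p/q\<close>. The congruence says
  \<open>\<tau>\<^sup>N \<equiv> -1\<close> modulo \<open>q\<close> in \<open>\<int>[\<tau>]\<close>, so \<open>T\<^sup>N x \<in> -x + \<int>[\<tau>]\<close>; the only point of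
  \<open>-x + \<int>[\<tau>]\<close> whose lift lies in the region is \<open>1 - x\<close>. Hence \<open>T\<^sup>N\<close> swaps \<open>x\<close> and
  \<open>1 - x\<close>, so the least period is \<open>2n\<close> for some \<open>n\<close> with \<open>T\<^sup>n x = 1 - x\<close>, and the two
  half-blocks have values \<open>\<tau>\<^sup>n x - (1 - x)\<close> and \<open>\<tau>\<^sup>n (1 - x) - x\<close>.\<close>

section \<open>Digits of \<open>\<beta>\<close>-expansions\<close>

lemma beta_trans_funpow_add:
  "(beta_trans \<beta> ^^ k) ((beta_trans \<beta> ^^ l) x) = (beta_trans \<beta> ^^ (k + l)) x"
  by (simp add: funpow_add)

lemma beta_trans_funpow_Suc:
  "(beta_trans \<beta> ^^ Suc k) x = \<beta> * (beta_trans \<beta> ^^ k) x - real_of_int (beta_digit \<beta> x (Suc k))"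
  by (simp add: beta_trans_def beta_digit_def)

lemma beta_trans_bounds: "0 \<le> beta_trans \<beta> x" "beta_trans \<beta> x < 1"
  unfolding beta_trans_def by linarith+

lemma beta_trans_funpow_bounds:
  assumes "0 \<le> x" "x < 1"
  shows "0 \<le> (beta_trans \<beta> ^^ k) x" "(beta_trans \<beta> ^^ k) x < 1"
  using assms by (cases k; simp add: beta_trans_bounds)+

lemma beta_digit_funpow:
  assumes "i \<ge> 1"
  shows "beta_digit \<beta> ((beta_trans \<beta> ^^ k) x) i = beta_digit \<beta> x (k + i)"
  using assms by (simp add: beta_digit_def beta_trans_funpow_add add.commute)

text \<open>The recursion for the orbit telescopes. This turns the block values in the Midy
  condition into points of the orbit.\<close>

lemma beta_digits_sum:
  "(\<Sum>i = 1..n. real_of_int (beta_digit \<beta> x i) * \<beta> ^ (n - i)) = \<beta> ^ n * x - (beta_trans \<beta> ^^ n) x"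
proof (induction n)
  case (Suc n)
  have "(\<Sum>i = 1..Suc n. real_of_int (beta_digit \<beta> x i) * \<beta> ^ (Suc n - i)) =
     (\<Sum>i = 1..n. \<beta> * (real_of_int (beta_digit \<beta> x i) * \<beta> ^ (n - i))) + real_of_int (beta_digit \<beta> x (Suc n))"
    by (auto intro!: sum.cong simp: Suc_diff_le)
  then show ?case
    unfolding sum_distrib_left [symmetric] Suc.IH beta_trans_funpow_Suc by (simp add: algebra_simps)
qed simp

text \<open>With equal digits, each step multiplies the difference of the two orbits by \<beta>, yet
  orbits in [0, 1) stay less than 1 apart.\<close>

lemma beta_expansion_unique:
  assumes "\<beta> > 1" "0 \<le> x" "x < 1" "0 \<le> y" "y < 1"
    and digits: "\<And>i. i \<ge> 1 \<Longrightarrow> beta_digit \<beta> x i = beta_digit \<beta> y i"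
  shows "x = y"
proof (rule ccontr)
  assume "x \<noteq> y"
  then obtain k where k: "1 / \<bar>x - y\<bar> < \<beta> ^ k"
    using real_arch_pow [OF \<open>\<beta> > 1\<close>] by blast
  have "\<beta> ^ k * (x - y) = (beta_trans \<beta> ^^ k) x - (beta_trans \<beta> ^^ k) y"
    using beta_digits_sum [of \<beta> x k] beta_digits_sum [of \<beta> y k]
    by (simp add: digits algebra_simps)
  moreover have "\<beta> ^ k * \<bar>x - y\<bar> = \<bar>\<beta> ^ k * (x - y)\<bar>"
    using \<open>\<beta> > 1\<close> by (simp add: abs_mult)
  ultimately have "\<beta> ^ k * \<bar>x - y\<bar> = \<bar>(beta_trans \<beta> ^^ k) x - (beta_trans \<beta> ^^ k) y\<bar>"
    by simp
  also have "\<dots> < 1"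
    using beta_trans_funpow_bounds [of x k \<beta>] beta_trans_funpow_bounds [of y k \<beta>] assms
    by linarith
  finally show False
    using k \<open>x \<noteq> y\<close> by (simp add: field_simps)
qed

text \<open>Shifting by a whole block leaves the digits unchanged, so uniqueness of expansions
  applies. Minimality among blocks thereby reduces to minimality among return times of
  \<open>x\<close>.\<close>

lemma purely_periodic_with_imp_funpow_eq:
  assumes "\<beta> > 1" "0 \<le> x" "x < 1" "purely_periodic_with \<beta> x cs"
  shows "(beta_trans \<beta> ^^ length cs) x = x"
proof (rule beta_expansion_unique [OF \<open>\<beta> > 1\<close>])
  fix i :: nat
  assume "i \<ge> 1"
  then have "(length cs + i - 1) mod length cs = (i - 1) mod length cs"
    by (metis Nat.add_diff_assoc mod_add_self1)
  with \<open>i \<ge> 1\<close> show "beta_digit \<beta> ((beta_trans \<beta> ^^ length cs) x) i = beta_digit \<beta> x i"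
    using assms(4) by (simp add: beta_digit_funpow purely_periodic_with_def)
qed (use assms beta_trans_funpow_bounds in auto)

lemma funpow_eq_mod:
  assumes "(f ^^ m) x = x"
  shows "(f ^^ k) x = (f ^^ (k mod m)) x"
proof -
  have "((f ^^ m) ^^ j) x = x" for j
    by (induction j) (use assms in auto)
  then have "(f ^^ (k mod m + m * (k div m))) x = (f ^^ (k mod m)) x"
    by (simp only: funpow_add funpow_mult [symmetric] o_apply)
  then show ?thesis
    by simp
qed

lemma funpow_eq_imp_purely_periodic_with:
  assumes "m \<ge> 1" "(beta_trans \<beta> ^^ m) x = x"
  shows "purely_periodic_with \<beta> x (map (beta_digit \<beta> x) [1..<Suc m])"
proof -
  define cs where "cs = map (beta_digit \<beta> x) [1..<Suc m]"
  have len: "length cs = m"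
    by (simp add: cs_def)
  then have "cs \<noteq> []"
    using assms(1) by auto
  moreover have "beta_digit \<beta> x i = cs ! ((i - 1) mod m)" if "i \<ge> 1" for i
  proof -
    have "(i - 1) mod m < m"
      using assms(1) by simp
    then show ?thesis
      using funpow_eq_mod [OF assms(2), of "i - 1"]
      by (simp add: cs_def beta_digit_def del: upt_Suc)
  qed
  ultimately show ?thesis
    unfolding purely_periodic_with_def cs_def [symmetric] len by blast
qed

lemma midy_if_funpow_swap:
  assumes "\<beta> > 1" "0 < p" "p < q" "coprime p q" "q > 2" "N > 0"
    and swap: "(beta_trans \<beta> ^^ N) (real p / real q) = 1 - real p / real q"
      "(beta_trans \<beta> ^^ N) (1 - real p / real q) = real p / real q"
  shows "testifies_midy \<beta> q p"
proof -
  define x where "x = real p / real q"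
  define T where "T = beta_trans \<beta>"
  have x: "0 \<le> x" "x < 1"
    using assms by (auto simp: x_def)
  have "(T ^^ (2 * N)) x = x"
    using swap by (simp add: T_def x_def mult_2 flip: beta_trans_funpow_add)
  then have ex: "\<exists>m. m \<ge> 1 \<and> (T ^^ m) x = x"
    using \<open>N > 0\<close> by (intro exI [of _ "2 * N"]) auto
  define m where "m = (LEAST m. m \<ge> 1 \<and> (T ^^ m) x = x)"
  have m: "m \<ge> 1" "(T ^^ m) x = x"
    using LeastI_ex [OF ex] by (auto simp: m_def)
  have m_least: "m \<le> k" if "k \<ge> 1" "(T ^^ k) x = x" for k
    unfolding m_def by (rule Least_le) (use that in auto)
  \<comment> \<open>\<open>N\<close> itself may exceed the least period \<open>m\<close>; its
    residue still sends \<open>x\<close> to \<open>1 - x\<close>, and is the candidate for half of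
    \<open>m\<close>.\<close>
  define n where "n = N mod m"
  have Tn: "(T ^^ n) x = 1 - x"
    using funpow_eq_mod [OF m(2), of N] swap by (simp add: n_def T_def x_def)
  \<comment> \<open>The fixed point 1/2 of the reflection has reduced denominator 2, which
    \<open>q > 2\<close> excludes.\<close>
  have "x \<noteq> 1 - x"
  proof
    assume "x = 1 - x"
    then have "real q = real (2 * p)"
      using assms by (simp add: x_def field_simps)
    then have "q = 2 * p"
      by linarith
    with \<open>coprime p q\<close> \<open>q > 2\<close> show False
      by simp
  qed
  then have "n \<ge> 1"
    using Tn by (cases n) auto
  have "n < m"
    using m(1) by (simp add: n_def)
  have T2n: "(T ^^ n) (1 - x) = x"
  proof -
    have "(T ^^ n) (1 - x) = (T ^^ n) ((T ^^ N) x)"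
      using swap by (simp add: T_def x_def)
    also have "\<dots> = (T ^^ N) ((T ^^ n) x)"
      by (simp add: T_def beta_trans_funpow_add add.commute)
    finally show ?thesis
      using swap Tn by (simp add: T_def x_def)
  qed
  then have T2nx: "(T ^^ (2 * n)) x = x"
    by (simp add: T_def mult_2 Tn [unfolded T_def] flip: beta_trans_funpow_add)
  \<comment> \<open>Otherwise \<open>2 * n - m\<close> would be a positive return time, smaller than
    \<open>m\<close> because \<open>n < m\<close>.\<close>
  have "m = 2 * n"
  proof (rule ccontr)
    assume "m \<noteq> 2 * n"
    moreover have "m \<le> 2 * n"
      using m_least T2nx \<open>n \<ge> 1\<close> by simp
    moreover have "(T ^^ (2 * n - m)) x = x"
    proof -
      have "(T ^^ (2 * n - m)) ((T ^^ m) x) = (T ^^ (2 * n)) x"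
        using \<open>m \<le> 2 * n\<close> by (simp add: T_def beta_trans_funpow_add)
      then show ?thesis
        using m T2nx by simp
    qed
    ultimately have "m \<le> 2 * n - m"
      by (intro m_least) simp_all
    with \<open>n < m\<close> show False
      by simp
  qed
  define cs where "cs = map (beta_digit \<beta> x) [1..<Suc m]"
  have len: "length cs = 2 * n"
    by (simp add: cs_def \<open>m = 2 * n\<close> del: upt_Suc)
  have "purely_periodic_with \<beta> x cs"
    unfolding cs_def using m by (intro funpow_eq_imp_purely_periodic_with) (auto simp: T_def)
  moreover have "length cs \<le> length ds" if "purely_periodic_with \<beta> x ds" for ds
  proof -
    have "length ds \<ge> 1"
      using that by (cases ds) (auto simp: purely_periodic_with_def)
    then show ?thesis
      using m_least purely_periodic_with_imp_funpow_eq [OF \<open>\<beta> > 1\<close> x that]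
      by (simp add: len T_def flip: \<open>m = 2 * n\<close>)
  qed
  ultimately have "shortest_period \<beta> x cs"
    by (simp add: shortest_period_def)
  have nth: "cs ! (i - 1) = beta_digit \<beta> x i" if "1 \<le> i" "i \<le> 2 * n" for i
    using that \<open>m = 2 * n\<close> by (simp add: cs_def del: upt_Suc)
  have "(\<Sum>i = 1..n. real_of_int (cs ! (i - 1)) * \<beta> ^ (n - i)) = \<beta> ^ n * x - (1 - x)"
    using beta_digits_sum [of \<beta> x n] Tn by (simp add: nth [simplified] T_def)
  moreover have "(\<Sum>i = 1..n. real_of_int (cs ! (n + i - 1)) * \<beta> ^ (n - i)) = \<beta> ^ n * (1 - x) - x"
  proof -
    have "cs ! (n + i - 1) = beta_digit \<beta> ((T ^^ n) x) i" if "i \<in> {1..n}" for i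
      using that nth [of "n + i"] by (simp add: T_def beta_digit_funpow)
    then show ?thesis
      using beta_digits_sum [of \<beta> "(T ^^ n) x" n] T2n unfolding Tn by (simp add: T_def)
  qed
  ultimately have "(\<Sum>i = 1..n. real_of_int (cs ! (i - 1)) * \<beta> ^ (n - i)) +
      (\<Sum>i = 1..n. real_of_int (cs ! (n + i - 1)) * \<beta> ^ (n - i)) = \<beta> ^ n - 1"
    by (simp add: algebra_simps)
  with \<open>shortest_period \<beta> x cs\<close> len \<open>n \<ge> 1\<close> show ?thesis
    using assms unfolding testifies_midy_def x_def by blast
qed

section \<open>The conjugate orbit in base \<open>\<tau>\<close>\<close>

lemma tau_square: "tau * tau = tau + 1"
  by (simp add: tau_def field_simps)

lemma tau_bounds: "1 < tau" "tau < 2"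
proof -
  have "2 < sqrt 5" "sqrt 5 < 3"
    by (auto intro: real_less_rsqrt real_less_lsqrt)
  then show "1 < tau" "tau < 2"
    by (auto simp: tau_def)
qed

text \<open>Here \<open>1 - tau\<close> is the conjugate \<open>-1/\<tau>\<close> of \<open>\<tau>\<close>.\<close>

fun conj_orbit :: "real \<Rightarrow> nat \<Rightarrow> real" where
  "conj_orbit x 0 = x"
| "conj_orbit x (Suc k) = (1 - tau) * conj_orbit x k - real_of_int (beta_digit tau x (Suc k))"

text \<open>The threshold \<open>tau - 1\<close> equals 1/\<tau>, where the digit jumps from 0 to 1.
  Digit 0 puts the next conjugate into (1 - \<tau>, 1). Digit 1 may push it down towards -\<tau>,
  but then \<open>z (Suc k) < tau - 1\<close>, where the weaker bound suffices.\<close>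

lemma conj_orbit_bounds:
  assumes "0 \<le> x" "x < 1"
  defines "z \<equiv> \<lambda>k. (beta_trans tau ^^ k) x"
  shows "- tau < conj_orbit x k \<and> conj_orbit x k < 1 \<and> (z k \<ge> tau - 1 \<longrightarrow> conj_orbit x k > 1 - tau)"
proof (induction k)
  case 0
  then show ?case
    using assms tau_bounds by simp
next
  case (Suc k)
  let ?y = "conj_orbit x k"
  have z: "0 \<le> z k" "z k < 1"
    using beta_trans_funpow_bounds assms by (auto simp: z_def)
  have digit: "beta_digit tau x (Suc k) = \<lfloor>tau * z k\<rfloor>"
    by (simp add: beta_digit_def z_def)
  show ?case
  proof (cases "z k < tau - 1")
    case True
    have "tau * z k < tau * (tau - 1)"
      using True tau_bounds by simp
    then have "tau * z k < 1"
      using tau_square by (simp add: algebra_simps)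
    then have "beta_digit tau x (Suc k) = 0"
      using z tau_bounds digit by (simp add: floor_eq_iff)
    moreover have "(tau - 1) * ?y < (tau - 1) * 1" "(tau - 1) * (- tau) < (tau - 1) * ?y"
      using Suc tau_bounds by - (rule mult_strict_left_mono; linarith)+
    then have "1 - tau < (1 - tau) * ?y" "(1 - tau) * ?y < 1"
      using tau_square by (simp_all add: algebra_simps)
    moreover have "conj_orbit x (Suc k) = (1 - tau) * ?y"
      using \<open>beta_digit tau x (Suc k) = 0\<close> by simp
    ultimately show ?thesis
      using tau_bounds by linarith
  next
    case False
    have "tau * (tau - 1) \<le> tau * z k" "tau * z k < tau * 1"
      using False z tau_bounds by simp_all
    then have tz: "1 \<le> tau * z k" "tau * z k < tau"
      using tau_square by (simp_all add: algebra_simps)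
    then have d: "beta_digit tau x (Suc k) = 1"
      using tau_bounds digit by (simp only: floor_eq_iff) linarith
    have "z (Suc k) = tau * z k - 1"
      using d unfolding z_def beta_trans_funpow_Suc by simp
    then have "z (Suc k) < tau - 1"
      using tz by simp
    moreover have "(tau - 1) * ?y < (tau - 1) * 1" "(tau - 1) * (1 - tau) < (tau - 1) * ?y"
      using Suc False tau_bounds by - (rule mult_strict_left_mono; linarith)+
    then have "1 - tau < (1 - tau) * ?y" "(1 - tau) * ?y < 2 - tau"
      using tau_square by (simp_all add: algebra_simps)
    moreover have "conj_orbit x (Suc k) = (1 - tau) * ?y - 1"
      using d by simp
    ultimately show ?thesis
      using tau_bounds by linarith
  qed
qed

text \<open>The same \<open>u\<close> and \<open>v\<close> serve both orbits: the induction step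
  uses only \<open>t * t = t + 1\<close>, which holds for \<open>tau\<close> and for
  \<open>1 - tau\<close>.\<close>

lemma orbit_representation:
  "\<exists>(u :: int) (v :: int). (beta_trans tau ^^ k) x = tau ^ k * x + u + v * tau \<and>
     conj_orbit x k = (1 - tau) ^ k * x + u + v * (1 - tau)"
proof (induction k)
  case 0
  then show ?case
    by (intro exI [of _ 0]) simp
next
  case (Suc k)
  then obtain u v :: int where uv: "(beta_trans tau ^^ k) x = tau ^ k * x + u + v * tau"
      "conj_orbit x k = (1 - tau) ^ k * x + u + v * (1 - tau)"
    by blast
  let ?d = "beta_digit tau x (Suc k)"
  have step: "t * (t ^ k * x + u + v * t) - ?d =
      t ^ Suc k * x + real_of_int (v - ?d) + real_of_int (u + v) * t"
    if "t * t = t + 1" for t :: real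
  proof -
    have "t * (t ^ k * x + u + v * t) - ?d = t ^ Suc k * x + u * t + v * (t * t) - ?d"
      by (simp add: algebra_simps)
    then show ?thesis
      using that by (simp add: algebra_simps)
  qed
  have "(1 - tau) * (1 - tau) = (1 - tau) + 1"
    using tau_square by (simp add: algebra_simps)
  then show ?case
    using step [OF tau_square] step [of "1 - tau"]
    unfolding beta_trans_funpow_Suc conj_orbit.simps uv by blast
qed

text \<open>The companion matrix represents multiplication by a root \<open>t\<close> of
  \<open>t * t = t + 1\<close>. Having \<open>a\<close> and \<open>b\<close> independent of the root
  lets one matrix congruence control both conjugates.\<close>

lemma tau_companion_pow:
  "\<exists>(a :: int) (b :: int). tau_companion ^\<^sub>m k = mat_of_rows_list 2 [[a, b], [b, a + b]] \<and>
     (\<forall>t :: real. t * t = t + 1 \<longrightarrow> t ^ k = a + b * t)"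
proof (induction k)
  case 0
  have "1\<^sub>m (dim_row tau_companion) = mat_of_rows_list 2 [[1, 0], [0, 1 + 0 :: int]]"
    by (rule eq_matI) (auto simp: tau_companion_def mat_of_rows_list_def numeral_2_eq_2 less_Suc_eq)
  then show ?case
    by (intro exI [of _ 1] exI [of _ 0]) simp
next
  case (Suc k)
  then obtain a b :: int where ab: "tau_companion ^\<^sub>m k = mat_of_rows_list 2 [[a, b], [b, a + b]]"
      "\<And>t :: real. t * t = t + 1 \<Longrightarrow> t ^ k = a + b * t"
    by blast
  have "tau_companion ^\<^sub>m Suc k = mat_of_rows_list 2 [[b, a + b], [a + b, b + (a + b)]]"
    unfolding pow_mat.simps ab(1)
    by (rule eq_matI) (auto simp: tau_companion_def mat_of_rows_list_def scalar_prod_def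
        numeral_2_eq_2 less_Suc_eq)
  moreover have "t ^ Suc k = b + real_of_int (a + b) * t" if "t * t = t + 1" for t :: real
  proof -
    have "t ^ Suc k = a * t + b * (t * t)"
      using ab(2) [OF that] by (simp add: algebra_simps)
    then show ?thesis
      using that by (simp add: algebra_simps)
  qed
  ultimately show ?case
    by blast
qed

lemma beta_trans_tau_funpow_swap:
  assumes "0 < p" "p < q" and cong: "mat_cong (tau_companion ^\<^sub>m N) (- 1\<^sub>m 2) (int q)"
  shows "(beta_trans tau ^^ N) (real p / real q) = 1 - real p / real q"
proof -
  define x where "x = real p / real q"
  have x: "0 < x" "x < 1"
    using assms by (auto simp: x_def)
  have qx: "q * x = p"
    using assms by (simp add: x_def)
  obtain a b :: int where ab: "tau_companion ^\<^sub>m N = mat_of_rows_list 2 [[a, b], [b, a + b]]"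
      "\<And>t :: real. t * t = t + 1 \<Longrightarrow> t ^ N = a + b * t"
    using tau_companion_pow by blast
  have "[a = - 1] (mod q)" "[b = 0] (mod q)"
    using cong unfolding mat_cong_def ab(1)
    by (auto simp: mat_of_rows_list_def numeral_2_eq_2 All_less_Suc)
  then obtain a' :: int and b' :: int where "a - (- 1) = q * a'" "b - 0 = q * b'"
    unfolding cong_iff_dvd_diff by (elim dvdE)
  then have "a = - 1 + q * a'" "b = q * b'"
    by simp_all
  \<comment> \<open>The factor \<open>q\<close> from the congruence cancels the denominator of
    \<open>x\<close>, leaving integer coefficients.\<close>
  then have pow: "t ^ N * x = - x + p * a' + p * b' * t" if "t * t = t + 1" for t :: real
  proof -
    have "t ^ N * x = - x + (q * x) * a' + (q * x) * b' * t"
      unfolding ab(2) [OF that] by (simp add: \<open>a = _\<close> \<open>b = _\<close> algebra_simps)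
    then show ?thesis
      by (simp add: qx)
  qed
  have conj_square: "(1 - tau) * (1 - tau) = (1 - tau) + 1"
    using tau_square by (simp add: algebra_simps)
  obtain u v :: int where uv: "(beta_trans tau ^^ N) x = tau ^ N * x + u + v * tau"
      "conj_orbit x N = (1 - tau) ^ N * x + u + v * (1 - tau)"
    using orbit_representation by blast
  define z where "z = (beta_trans tau ^^ N) x"
  define y where "y = conj_orbit x N"
  define r where "r = u + p * a'"
  define s where "s = v + p * b'"
  have z: "z = - x + r + s * tau" and y: "y = - x + r + s * (1 - tau)"
    unfolding z_def y_def r_def s_def uv pow [OF tau_square] pow [OF conj_square]
    by (simp_all add: algebra_simps)
  have zb: "0 \<le> z" "z < 1"
    using beta_trans_funpow_bounds x by (simp_all add: z_def)
  have yb: "- tau < y" "y < 1" "z \<ge> tau - 1 \<Longrightarrow> y > 1 - tau"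
    using conj_orbit_bounds [of x N] x by (simp_all add: z_def y_def)
  \<comment> \<open>Subtracting the conjugate isolates \<open>s\<close>, so bounds on
    \<open>z - y\<close> can force \<open>s = 0\<close>.\<close>
  have diff: "z - y = s * (2 * tau - 1)"
    unfolding z y by (simp add: algebra_simps)
  \<comment> \<open>\<open>2 * tau - 1\<close> is \<open>\<surd>5\<close>, the sharp bound for \<open>z - y\<close> on the part \<open>z < 1/\<tau>\<close> of the region.\<close>
  have "z - y < 2 * tau - 1"
    using yb zb tau_bounds by (cases "z \<ge> tau - 1") linarith+
  then have "s < 1"
    unfolding diff using tau_bounds by simp
  moreover have "s > - 1"
  proof (rule ccontr)
    assume "\<not> s > - 1"
    then have "s * (2 * tau - 1) \<le> (- 1) * (2 * tau - 1)"
      using tau_bounds by (intro mult_right_mono) auto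
    then have "z - y \<le> 1 - 2 * tau"
      unfolding diff by simp
    then show False
      using yb(2) zb(1) tau_bounds by linarith
  qed
  ultimately have "s = 0"
    by simp
  \<comment> \<open>Now \<open>z = r - x\<close> lies in [0, 1): \<open>x > 0\<close> rules out
    \<open>r \<le> 0\<close> and \<open>x < 1\<close> rules out \<open>r \<ge> 2\<close>.\<close>
  then have "r = 1"
    using z zb x by simp
  then show ?thesis
    using z \<open>s = 0\<close> by (simp add: z_def x_def)
qed

theorem theorem4p1:
  fixes q N :: nat
  assumes "q > 2" and "N > 1"
    and "mat_cong (tau_companion ^\<^sub>m N) (- 1\<^sub>m 2) (int q)"
  shows "midy_property tau q \<and>
    (\<forall>p::nat. 0 < p \<and> p < q \<and> coprime p q \<longrightarrow> testifies_midy tau q p)"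
proof -
  have testifies: "testifies_midy tau q p" if "0 < p" "p < q" "coprime p q" for p
  proof (rule midy_if_funpow_swap [where N = N])
    \<comment> \<open>The reflected point is again a fraction over \<open>q\<close>, so the same
      lemma gives the swap back.\<close>
    have "real (q - p) / real q = 1 - real p / real q"
      using that by (simp add: of_nat_diff field_simps)
    then show "(beta_trans tau ^^ N) (1 - real p / real q) = real p / real q"
      using beta_trans_tau_funpow_swap [of "q - p" q N] that assms by simp
  qed (use that assms tau_bounds beta_trans_tau_funpow_swap in auto)
  moreover have "testifies_midy tau q 1"
    using \<open>q > 2\<close> by (intro testifies) auto
  ultimately show ?thesis
    unfolding midy_property_def by blast
qed

end
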